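(* Let $(X,d)$ be a uniformly discrete bounded geometry metric space, and let $\{\phi_i : X\to Y_i\}_{i=1}^n$ be a strongly embeddable family of maps. If the preimages $\{\phi_i^{-1}(w) : w\in Y_i,\ i=1,\ldots,n\}$, with the metrics restricted from $X$, are an equi-strongly embeddable family of metric spaces, then $X$ is strongly embeddable.
   Context: A metric space is uniformly discrete if distinct points are at distance at least some fixed $\delta>0$, and has bounded geometry if for every $r>0$ the cardinality of balls of radius $r$ is uniformly bounded. $B_S(x)=\{y : d(x,y)<S\}$ denotes the ball of radius $S$ centered at $x$ in the metric space under consideration. Strong embeddability: $(X,d)$ is strongly embeddable if for every $R,\epsilon>0$ there exists a map $\beta : X \to \ell^2(X)$, $x \mapsto \beta_x$, with $\|\beta_x\|=1$ for each $x\in X$, such that: (1) if $d(x,y)\le R$ then $\|\beta_x-\beta_y\|\le\epsilon$; (2) $\lim_{S\to\infty}\sup_{x\in X}\sum_{w\notin B_S(x)}|\beta_x(w)|^2=0$. Equi-strong embeddability: a family $(X_j)_{j\in\mathcal{I}}$ of metric spaces is equi-strongly embeddable if for every $R,\epsilon>0$ there is a family of maps $\xi^j : X_j\to\ell^2(X_j)$, $x\mapsto\xi^j_x$, with $\|\xi^j_x\|=1$ for all $x\in X_j$, such that: (1) for all $j\in\mathcal{I}$ and all $x,y\in X_j$ with $d(x,y)\le R$, $\|\xi^j_x-\xi^j_y\|\le\epsilon$; (2) $\lim_{S\to\infty}\sup_{j\in\mathcal{I}}\sup_{x\in X_j}\sum_{w\in X_j,\,w\notin B_S(x)}|\xi^j_x(w)|^2=0$.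 Strongly embeddable family of maps: for a finite family of sets $Y_1,\ldots,Y_n$, let $\mathcal{Y}=\bigsqcup_{i=1}^n Y_i$ be the disjoint union (each $Y_i$ regarded as a subset of $\mathcal{Y}$). A family of set maps $\{\phi_i : X\to Y_i\}_{i=1}^n$ is a strongly embeddable family of maps if for every $R,\epsilon>0$ there exists a map $\xi : X\to\ell^2(\mathcal{Y})$, $x\mapsto\xi_x$, with $\|\xi_x\|=1$ for all $x\in X$, such that: (1) for all $x,y\in X$ with $d(x,y)\le R$, $\|\xi_x-\xi_y\|\le\epsilon$; (2) $\lim_{S\to\infty}\sup_{x\in X}\sum_{w\notin\bigcup_i\phi_i(B_S(x))}|\xi_x(w)|^2=0$. *)

theory Defs
  imports "HOL-Analysis.Analysis"
begin

(* Elements of the complex Hilbert space l^2(A) are represented by functions on the whole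
   type that vanish off A. *)

definition ell2 :: "'a set \<Rightarrow> ('a \<Rightarrow> complex) set" where
  "ell2 A = {f. (\<forall>w. w \<notin> A \<longrightarrow> f w = 0) \<and> (\<lambda>w. (cmod (f w))\<^sup>2) summable_on A}"

definition ell2_norm :: "'a set \<Rightarrow> ('a \<Rightarrow> complex) \<Rightarrow> real" where
  "ell2_norm A f = sqrt (\<Sum>\<^sub>\<infinity>w\<in>A. (cmod (f w))\<^sup>2)"

definition uniformly_discrete :: "'a set \<Rightarrow> ('a \<Rightarrow> 'a \<Rightarrow> real) \<Rightarrow> bool" where
  "uniformly_discrete X d \<longleftrightarrow> (\<exists>\<delta>>0. \<forall>x\<in>X. \<forall>y\<in>X. x \<noteq> y \<longrightarrow> \<delta> \<le> d x y)"

definition bounded_geometry :: "'a set \<Rightarrow> ('a \<Rightarrow> 'a \<Rightarrow> real) \<Rightarrow> bool" where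
  "bounded_geometry X d \<longleftrightarrow>
     (\<forall>r>0. \<exists>N::nat. \<forall>x\<in>X. finite (Metric_space.mball X d x r) \<and>
                            card (Metric_space.mball X d x r) \<le> N)"

(* The suprema below are taken in ennreal, so that a supremum over the empty set is 0;
   the inner sums are real and converge because the functions lie in l^2. *)

definition strongly_embeddable :: "'a set \<Rightarrow> ('a \<Rightarrow> 'a \<Rightarrow> real) \<Rightarrow> bool" where
  "strongly_embeddable X d \<longleftrightarrow>
     (\<forall>R>0. \<forall>\<epsilon>>0. \<exists>\<beta>::'a \<Rightarrow> 'a \<Rightarrow> complex.
        (\<forall>x\<in>X. \<beta> x \<in> ell2 X \<and> ell2_norm X (\<beta> x) = 1) \<and>
        (\<forall>x\<in>X. \<forall>y\<in>X. d x y \<le> R \<longrightarrow> ell2_norm X (\<lambda>w. \<beta> x w - \<beta> y w) \<le> \<epsilon>) \<and>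
        ((\<lambda>S::real. SUP x\<in>X.
            ennreal (\<Sum>\<^sub>\<infinity>w\<in>X - Metric_space.mball X d x S. (cmod (\<beta> x w))\<^sup>2))
          \<longlongrightarrow> 0) at_top)"

definition equi_strongly_embeddable ::
    "'j set \<Rightarrow> ('j \<Rightarrow> 'a set) \<Rightarrow> ('j \<Rightarrow> 'a \<Rightarrow> 'a \<Rightarrow> real) \<Rightarrow> bool" where
  "equi_strongly_embeddable J X d \<longleftrightarrow>
     (\<forall>R>0. \<forall>\<epsilon>>0. \<exists>\<xi>::'j \<Rightarrow> 'a \<Rightarrow> 'a \<Rightarrow> complex.
        (\<forall>j\<in>J. \<forall>x\<in>X j. \<xi> j x \<in> ell2 (X j) \<and> ell2_norm (X j) (\<xi> j x) = 1) \<and>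
        (\<forall>j\<in>J. \<forall>x\<in>X j. \<forall>y\<in>X j. d j x y \<le> R \<longrightarrow>
            ell2_norm (X j) (\<lambda>w. \<xi> j x w - \<xi> j y w) \<le> \<epsilon>) \<and>
        ((\<lambda>S::real. SUP j\<in>J. SUP x\<in>X j.
            ennreal (\<Sum>\<^sub>\<infinity>w\<in>X j - Metric_space.mball (X j) (d j) x S. (cmod (\<xi> j x w))\<^sup>2))
          \<longlongrightarrow> 0) at_top)"

(* The disjoint union of Y 1, ..., Y n is the set of pairs (i, w) with w in Y i. *)

definition strongly_embeddable_maps ::
    "'a set \<Rightarrow> ('a \<Rightarrow> 'a \<Rightarrow> real) \<Rightarrow> nat \<Rightarrow> (nat \<Rightarrow> 'b set) \<Rightarrow> (nat \<Rightarrow> 'a \<Rightarrow> 'b) \<Rightarrow> bool" where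
  "strongly_embeddable_maps X d n Y \<phi> \<longleftrightarrow>
     (\<forall>R>0. \<forall>\<epsilon>>0. \<exists>\<xi>::'a \<Rightarrow> nat \<times> 'b \<Rightarrow> complex.
        (\<forall>x\<in>X. \<xi> x \<in> ell2 (Sigma {1..n} Y) \<and> ell2_norm (Sigma {1..n} Y) (\<xi> x) = 1) \<and>
        (\<forall>x\<in>X. \<forall>y\<in>X. d x y \<le> R \<longrightarrow>
            ell2_norm (Sigma {1..n} Y) (\<lambda>w. \<xi> x w - \<xi> y w) \<le> \<epsilon>) \<and>
        ((\<lambda>S::real. SUP x\<in>X.
            ennreal (\<Sum>\<^sub>\<infinity>w\<in>Sigma {1..n} Y -
                          (\<Union>i\<in>{1..n}. (\<lambda>y. (i, \<phi> i y)) ` Metric_space.mball X d x S).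
                        (cmod (\<xi> x w))\<^sup>2))
          \<longlongrightarrow> 0) at_top)"

end

theory Submission
  imports Defs
begin

text \<open>
  Suppose that unit vectors \<open>\<xi>\<^sub>x \<in> \<ell>\<^sup>2(J)\<close> and \<open>k\<^sub>x\<^sub>,\<^sub>j \<in> \<ell>\<^sup>2(X)\<close> are given, and let \<open>\<beta>\<^sub>x(z)\<close> be the norm in
  \<open>\<ell>\<^sup>2(J)\<close> of \<open>j \<mapsto> \<xi>\<^sub>x(j) k\<^sub>x\<^sub>,\<^sub>j(z)\<close>. By Tonelli's theorem \<open>\<beta>\<^sub>x\<close> is a unit vector of \<open>\<ell>\<^sup>2(X)\<close>, and it has small
  mass wherever all \<open>k\<^sub>x\<^sub>,\<^sub>j\<close> have small mass. By the reverse triangle inequality in \<open>\<ell>\<^sup>2(J)\<close>, \<open>\<beta>\<^sub>x - \<beta>\<^sub>y\<close> is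
  no larger than the function \<open>\<xi>\<^sub>x(j) k\<^sub>x\<^sub>,\<^sub>j(z) - \<xi>\<^sub>y(j) k\<^sub>y\<^sub>,\<^sub>j(z)\<close> in \<open>\<ell>\<^sup>2(J \<times> X)\<close>.

  Take for \<open>J\<close> the disjoint union of the \<open>Y\<^sub>i\<close>, for \<open>\<xi>\<close> the vectors provided by the family of maps, and a
  radius \<open>T\<close> such that \<open>\<xi>\<^sub>x\<close> has norm at most \<open>\<delta>\<close> off the image of the \<open>T\<close>-ball about \<open>x\<close>. If the fibre of \<open>j\<close>
  contains a point within \<open>T\<close> of \<open>x\<close>, let \<open>k\<^sub>x\<^sub>,\<^sub>j\<close> be the vector of the equi-strong embedding of the fibres at such
  a point; otherwise let it be the Dirac vector at \<open>x\<close>, so that no mass is lost and no normalisation is needed.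
  For \<open>d(x,y) \<le> R\<close> the chosen points of a fibre are at distance at most \<open>R + 2T\<close>, so the fibres have to be
  embedded at that scale.
\<close>

section \<open>Square-summable functions\<close>

definition square_summable_on :: "('a \<Rightarrow> complex) \<Rightarrow> 'a set \<Rightarrow> bool"
    (infixr \<open>square'_summable'_on\<close> 46) where
  "f square_summable_on A \<longleftrightarrow> (\<lambda>w. (cmod (f w))\<^sup>2) summable_on A"

lemma ell2_iff: "f \<in> ell2 A \<longleftrightarrow> (\<forall>w. w \<notin> A \<longrightarrow> f w = 0) \<and> f square_summable_on A"
  by (simp add: ell2_def square_summable_on_def)

lemma square_summable_on_subset:
  "f square_summable_on A \<Longrightarrow> B \<subseteq> A \<Longrightarrow> f square_summable_on B"
  unfolding square_summable_on_def by (rule summable_on_subset_banach)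

lemma ell2_norm_nonneg [simp]: "0 \<le> ell2_norm A f"
  by (simp add: ell2_norm_def infsum_nonneg)

lemma ell2_norm_power2: "(ell2_norm A f)\<^sup>2 = (\<Sum>\<^sub>\<infinity>w\<in>A. (cmod (f w))\<^sup>2)"
  by (simp add: ell2_norm_def infsum_nonneg)

lemma infsum_le_power2_iff_ell2_norm_le:
  assumes "0 \<le> c"
  shows "(\<Sum>\<^sub>\<infinity>w\<in>A. (cmod (f w))\<^sup>2) \<le> c\<^sup>2 \<longleftrightarrow> ell2_norm A f \<le> c"
  using assms by (simp flip: ell2_norm_power2)

lemma L2_set_le_ell2_norm:
  assumes "f square_summable_on A" "finite F" "F \<subseteq> A"
  shows "L2_set (\<lambda>w. cmod (f w)) F \<le> ell2_norm A f"
  unfolding L2_set_def ell2_norm_def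
  using assms by (intro real_sqrt_le_mono finite_sum_le_infsum) (auto simp: square_summable_on_def)

lemma
  assumes "\<And>F. finite F \<Longrightarrow> F \<subseteq> A \<Longrightarrow> L2_set (\<lambda>w. cmod (f w)) F \<le> c"
  shows square_summable_on_if_L2_set_le: "f square_summable_on A"
    and ell2_norm_le_if_L2_set_le: "ell2_norm A f \<le> c"
proof -
  have "0 \<le> c"
    using assms[of "{}"] by simp
  then have sum_le: "(\<Sum>w\<in>F. (cmod (f w))\<^sup>2) \<le> c\<^sup>2" if "finite F" "F \<subseteq> A" for F
    using assms[OF that] unfolding L2_set_def by (simp add: real_sqrt_le_iff' sum_nonneg)
  then show summable: "f square_summable_on A"
    unfolding square_summable_on_def
    by (intro nonneg_bdd_above_summable_on bdd_aboveI2[where M = "c\<^sup>2"]) auto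
  have "(\<Sum>\<^sub>\<infinity>w\<in>A. (cmod (f w))\<^sup>2) \<le> c\<^sup>2"
    using summable sum_le unfolding square_summable_on_def by (intro infsum_le_finite_sums) auto
  then show "ell2_norm A f \<le> c"
    using \<open>0 \<le> c\<close> by (simp add: infsum_le_power2_iff_ell2_norm_le)
qed

lemma
  assumes f: "f square_summable_on A" and g: "g square_summable_on A"
    and h_le: "\<And>w. w \<in> A \<Longrightarrow> cmod (h w) \<le> cmod (f w) + cmod (g w)"
  shows square_summable_on_dominated_add: "h square_summable_on A"
    and ell2_norm_dominated_add: "ell2_norm A h \<le> ell2_norm A f + ell2_norm A g"
proof -
  have L2_set_le: "L2_set (\<lambda>w. cmod (h w)) F \<le> ell2_norm A f + ell2_norm A g"
    if F: "finite F" "F \<subseteq> A" for F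
  proof -
    have "L2_set (\<lambda>w. cmod (h w)) F \<le> L2_set (\<lambda>w. cmod (f w) + cmod (g w)) F"
      using F h_le by (intro L2_set_mono) auto
    also have "\<dots> \<le> L2_set (\<lambda>w. cmod (f w)) F + L2_set (\<lambda>w. cmod (g w)) F"
      by (rule L2_set_triangle_ineq)
    also have "\<dots> \<le> ell2_norm A f + ell2_norm A g"
      using F by (intro add_mono L2_set_le_ell2_norm f g)
    finally show ?thesis .
  qed
  show "h square_summable_on A"
    by (rule square_summable_on_if_L2_set_le) (rule L2_set_le)
  show "ell2_norm A h \<le> ell2_norm A f + ell2_norm A g"
    by (rule ell2_norm_le_if_L2_set_le) (rule L2_set_le)
qed

lemma square_summable_on_diff:
  assumes "f square_summable_on A" "g square_summable_on A"
  shows "(\<lambda>w. f w - g w) square_summable_on A"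
  using assms by (rule square_summable_on_dominated_add) (rule norm_triangle_ineq4)

lemma
  assumes "f square_summable_on A" "g square_summable_on A"
  shows ell2_norm_triangle_ineq4: "ell2_norm A (\<lambda>w. f w - g w) \<le> ell2_norm A f + ell2_norm A g"
    and ell2_norm_triangle_ineq3:
      "\<bar>ell2_norm A f - ell2_norm A g\<bar> \<le> ell2_norm A (\<lambda>w. f w - g w)"
proof -
  note diff = square_summable_on_diff[OF assms]
  show "ell2_norm A (\<lambda>w. f w - g w) \<le> ell2_norm A f + ell2_norm A g"
    using assms by (rule ell2_norm_dominated_add) (rule norm_triangle_ineq4)
  have "ell2_norm A f \<le> ell2_norm A (\<lambda>w. f w - g w) + ell2_norm A g"
    using diff assms(2) by (rule ell2_norm_dominated_add) (metis diff_add_cancel norm_triangle_ineq)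
  moreover have "ell2_norm A g \<le> ell2_norm A f + ell2_norm A (\<lambda>w. f w - g w)"
    using assms(1) diff by (rule ell2_norm_dominated_add) (metis norm_triangle_sub norm_minus_commute)
  ultimately show "\<bar>ell2_norm A f - ell2_norm A g\<bar> \<le> ell2_norm A (\<lambda>w. f w - g w)"
    by (simp add: abs_le_iff)
qed

lemma ell2_norm_cong:
  "(\<And>w. w \<in> A \<Longrightarrow> cmod (f w) = cmod (g w)) \<Longrightarrow> ell2_norm A f = ell2_norm A g"
  unfolding ell2_norm_def by (intro arg_cong[where f = sqrt] infsum_cong) simp

lemma ell2_norm_zero [simp]: "ell2_norm A (\<lambda>_. 0) = 0"
  by (simp add: ell2_norm_def)

lemma square_summable_on_zero [simp]: "(\<lambda>_. 0) square_summable_on A"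
  by (simp add: square_summable_on_def)

lemma
  assumes "g square_summable_on A" "\<And>w. w \<in> A \<Longrightarrow> cmod (f w) \<le> cmod (g w)"
  shows square_summable_on_mono: "f square_summable_on A"
    and ell2_norm_mono: "ell2_norm A f \<le> ell2_norm A g"
  using square_summable_on_dominated_add[of g A "\<lambda>_. 0" f]
    ell2_norm_dominated_add[of g A "\<lambda>_. 0" f] assms
  by simp_all

lemma ell2_norm_dominated_sum_list:
  assumes "\<And>f. f \<in> set fs \<Longrightarrow> f square_summable_on A"
    and "\<And>w. w \<in> A \<Longrightarrow> cmod (h w) \<le> (\<Sum>f\<leftarrow>fs. cmod (f w))"
  shows "h square_summable_on A \<and> ell2_norm A h \<le> (\<Sum>f\<leftarrow>fs. ell2_norm A f)"
  using assms
proof (induction fs arbitrary: h)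
  case Nil
  then show ?case
    using ell2_norm_mono[of "\<lambda>_. 0" A h] square_summable_on_mono[of "\<lambda>_. 0" A h]
    by simp
next
  case (Cons f fs)
  define g where "g w = complex_of_real (\<Sum>f\<leftarrow>fs. cmod (f w))" for w
  have cmod_g: "cmod (g w) = (\<Sum>f\<leftarrow>fs. cmod (f w))" for w
    unfolding g_def norm_of_real by (intro abs_of_nonneg sum_list_nonneg) auto
  have f: "f square_summable_on A"
    using Cons.prems(1) by simp
  have g: "g square_summable_on A" "ell2_norm A g \<le> (\<Sum>f\<leftarrow>fs. ell2_norm A f)"
    using Cons.IH[of g] Cons.prems(1) by (simp_all add: cmod_g)
  have h_le: "\<And>w. w \<in> A \<Longrightarrow> cmod (h w) \<le> cmod (f w) + cmod (g w)"
    using Cons.prems(2) by (simp add: cmod_g)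
  show ?case
    using square_summable_on_dominated_add[OF f g(1) h_le]
      ell2_norm_dominated_add[OF f g(1) h_le] g(2)
    by simp
qed

lemma square_summable_on_mult_left:
  "f square_summable_on A \<Longrightarrow> (\<lambda>w. c * f w) square_summable_on A"
  unfolding square_summable_on_def
  by (simp add: norm_mult power_mult_distrib summable_on_cmult_right)

lemma ell2_norm_mult_left: "ell2_norm A (\<lambda>w. c * f w) = cmod c * ell2_norm A f"
  by (simp add: ell2_norm_def norm_mult power_mult_distrib infsum_cmult_right' real_sqrt_mult)

lemma
  assumes "f \<in> ell2 A"
  shows square_summable_on_if_ell2: "f square_summable_on B"
    and ell2_norm_eq_Int: "ell2_norm B f = ell2_norm (A \<inter> B) f"
proof -
  have "f square_summable_on (A \<inter> B)" and off: "\<And>w. w \<notin> A \<Longrightarrow> f w = 0"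
    using assms by (auto simp: ell2_iff intro: square_summable_on_subset)
  then show "f square_summable_on B"
    unfolding square_summable_on_def by (elim summable_on_cong_neutral[THEN iffD1, rotated -1]) auto
  show "ell2_norm B f = ell2_norm (A \<inter> B) f"
    unfolding ell2_norm_def by (intro arg_cong[where f = sqrt] infsum_cong_neutral) (auto simp: off)
qed

lemma
  assumes "f square_summable_on A" "B \<subseteq> A"
  shows square_summable_on_restrict: "(\<lambda>w. if w \<in> B then f w else 0) square_summable_on A"
    and ell2_norm_restrict: "ell2_norm A (\<lambda>w. if w \<in> B then f w else 0) = ell2_norm B f"
proof -
  show "(\<lambda>w. if w \<in> B then f w else 0) square_summable_on A"
    using assms(1) by (rule square_summable_on_mono) simp
  show "ell2_norm A (\<lambda>w. if w \<in> B then f w else 0) = ell2_norm B f"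
    unfolding ell2_norm_def using assms(2)
    by (intro arg_cong[where f = sqrt] infsum_cong_neutral) auto
qed

lemma ell2_norm_subset_le:
  assumes "f square_summable_on A" "B \<subseteq> A"
  shows "ell2_norm B f \<le> ell2_norm A f"
  using ell2_norm_mono[of f A "\<lambda>w. if w \<in> B then f w else 0"] ell2_norm_restrict[OF assms] assms(1)
  by simp

definition ell2_dirac :: "'a \<Rightarrow> 'a \<Rightarrow> complex" where
  "ell2_dirac x = (\<lambda>w. if w = x then 1 else 0)"

lemma ell2_dirac_in_ell2: "x \<in> A \<Longrightarrow> ell2_dirac x \<in> ell2 A"
  by (auto simp: ell2_def ell2_dirac_def if_distrib if_distribR intro: finite_nonzero_values_imp_summable_on)

lemma ell2_norm_dirac: "ell2_norm A (ell2_dirac x) = (if x \<in> A then 1 else 0)"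
proof -
  have "ell2_norm A (ell2_dirac x) = ell2_norm ({x} \<inter> A) (ell2_dirac x)"
    by (intro ell2_norm_eq_Int ell2_dirac_in_ell2) simp
  then show ?thesis
    by (simp add: ell2_norm_def ell2_dirac_def)
qed

section \<open>Mixtures of square-summable functions\<close>

definition ell2_marginal :: "'j set \<Rightarrow> ('j \<Rightarrow> 'a \<Rightarrow> complex) \<Rightarrow> 'a \<Rightarrow> complex" where
  "ell2_marginal J u z = complex_of_real (ell2_norm J (\<lambda>j. u j z))"

lemma cmod_ell2_marginal: "cmod (ell2_marginal J u z) = ell2_norm J (\<lambda>j. u j z)"
  by (simp add: ell2_marginal_def)

lemma
  fixes f :: "'a \<Rightarrow> 'b \<Rightarrow> real"
  assumes nonneg: "\<And>x y. x \<in> A \<Longrightarrow> y \<in> B \<Longrightarrow> 0 \<le> f x y"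
    and inner: "\<And>x. x \<in> A \<Longrightarrow> f x summable_on B"
    and outer: "(\<lambda>x. \<Sum>\<^sub>\<infinity>y\<in>B. f x y) summable_on A"
  shows summable_on_Tonelli_inner: "y \<in> B \<Longrightarrow> (\<lambda>x. f x y) summable_on A"
    and summable_on_Tonelli_outer: "(\<lambda>y. \<Sum>\<^sub>\<infinity>x\<in>A. f x y) summable_on B"
    and infsum_Tonelli: "(\<Sum>\<^sub>\<infinity>y\<in>B. \<Sum>\<^sub>\<infinity>x\<in>A. f x y) = (\<Sum>\<^sub>\<infinity>x\<in>A. \<Sum>\<^sub>\<infinity>y\<in>B. f x y)"
proof -
  have prod: "(\<lambda>(x, y). f x y) summable_on A \<times> B"
    using nonneg inner outer by (intro summable_on_SigmaI) (auto intro: has_sum_infsum)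
  then have prod': "(\<lambda>(y, x). f x y) summable_on B \<times> A"
    by (subst summable_on_swap) simp
  show "(\<lambda>x. f x y) summable_on A" if "y \<in> B" for y
    using summable_on_SigmaD1[OF prod' that] .
  show "(\<lambda>y. \<Sum>\<^sub>\<infinity>x\<in>A. f x y) summable_on B"
    using summable_on_Sigma_banach[OF prod'] .
  show "(\<Sum>\<^sub>\<infinity>y\<in>B. \<Sum>\<^sub>\<infinity>x\<in>A. f x y) = (\<Sum>\<^sub>\<infinity>x\<in>A. \<Sum>\<^sub>\<infinity>y\<in>B. f x y)"
    using infsum_swap_banach[OF prod] by simp
qed

lemma
  assumes "\<And>j. j \<in> J \<Longrightarrow> u j square_summable_on B"
    and "ell2_marginal B (\<lambda>z j. u j z) square_summable_on J"
  shows square_summable_on_section: "z \<in> B \<Longrightarrow> (\<lambda>j. u j z) square_summable_on J"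
    and square_summable_on_marginal: "ell2_marginal J u square_summable_on B"
    and ell2_norm_marginal_swap:
      "ell2_norm B (ell2_marginal J u) = ell2_norm J (ell2_marginal B (\<lambda>z j. u j z))"
proof -
  have inner: "\<And>j. j \<in> J \<Longrightarrow> (\<lambda>z. (cmod (u j z))\<^sup>2) summable_on B"
    and outer: "(\<lambda>j. \<Sum>\<^sub>\<infinity>z\<in>B. (cmod (u j z))\<^sup>2) summable_on J"
    using assms by (simp_all add: square_summable_on_def cmod_ell2_marginal ell2_norm_power2)
  note Tonelli = summable_on_Tonelli_inner summable_on_Tonelli_outer infsum_Tonelli
  note Tonelli_u = Tonelli[of J B "\<lambda>j z. (cmod (u j z))\<^sup>2", OF zero_le_power2 inner outer]
  show "z \<in> B \<Longrightarrow> (\<lambda>j. u j z) square_summable_on J"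
    and "ell2_marginal J u square_summable_on B"
    using Tonelli_u(1,2) by (simp_all add: square_summable_on_def cmod_ell2_marginal ell2_norm_power2)
  show "ell2_norm B (ell2_marginal J u) = ell2_norm J (ell2_marginal B (\<lambda>z j. u j z))"
    using Tonelli_u(3) by (simp add: ell2_norm_def[of B "ell2_marginal J u"]
      ell2_norm_def[of J "ell2_marginal B _"] cmod_ell2_marginal ell2_norm_power2)
qed

lemma ell2_norm_marginal_diff_le:
  assumes u: "\<And>j. j \<in> J \<Longrightarrow> u j square_summable_on B" "ell2_marginal B (\<lambda>z j. u j z) square_summable_on J"
    and v: "\<And>j. j \<in> J \<Longrightarrow> v j square_summable_on B" "ell2_marginal B (\<lambda>z j. v j z) square_summable_on J"
  shows "ell2_norm B (\<lambda>z. ell2_marginal J u z - ell2_marginal J v z)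
    \<le> ell2_norm J (ell2_marginal B (\<lambda>z j. u j z - v j z))"
proof -
  define w where "w = (\<lambda>j z. u j z - v j z)"
  have w_summable: "\<And>j. j \<in> J \<Longrightarrow> w j square_summable_on B"
    unfolding w_def using u(1) v(1) by (rule square_summable_on_diff)
  have w_marginal: "ell2_marginal B (\<lambda>z j. w j z) square_summable_on J"
    using u(2) v(2) by (rule square_summable_on_dominated_add)
      (simp add: w_def cmod_ell2_marginal ell2_norm_triangle_ineq4 u v)
  have marginal_w_summable: "ell2_marginal J w square_summable_on B"
    using w_summable w_marginal by (rule square_summable_on_marginal)
  have "cmod (ell2_marginal J u z - ell2_marginal J v z) \<le> cmod (ell2_marginal J w z)"
    if "z \<in> B" for z
    using ell2_norm_triangle_ineq3[OF square_summable_on_section[OF u that]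
        square_summable_on_section[OF v that]]
    by (simp add: w_def ell2_marginal_def flip: of_real_diff)
  then have "ell2_norm B (\<lambda>z. ell2_marginal J u z - ell2_marginal J v z) \<le> ell2_norm B (ell2_marginal J w)"
    by (rule ell2_norm_mono[OF marginal_w_summable])
  also have "\<dots> = ell2_norm J (ell2_marginal B (\<lambda>z j. u j z - v j z))"
    using ell2_norm_marginal_swap[OF w_summable w_marginal] by (simp add: w_def)
  finally show ?thesis .
qed

definition ell2_mixture :: "'j set \<Rightarrow> ('j \<Rightarrow> complex) \<Rightarrow> ('j \<Rightarrow> 'a \<Rightarrow> complex) \<Rightarrow> 'a \<Rightarrow> complex" where
  "ell2_mixture J a k = ell2_marginal J (\<lambda>j z. a j * k j z)"

lemma square_summable_on_marginal_mult:
  assumes "a square_summable_on J" "\<And>j. j \<in> J \<Longrightarrow> ell2_norm B (k j) \<le> t"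
  shows "ell2_marginal B (\<lambda>z j. a j * k j z) square_summable_on J"
  using square_summable_on_mult_left[OF assms(1), of "complex_of_real t"]
proof (rule square_summable_on_mono)
  fix j assume "j \<in> J"
  then have "\<bar>ell2_norm B (k j)\<bar> \<le> \<bar>t\<bar>"
    using assms(2) by (simp add: order_trans[OF _ abs_ge_self])
  then show "cmod (ell2_marginal B (\<lambda>z j. a j * k j z) j) \<le> cmod (complex_of_real t * a j)"
    by (simp add: cmod_ell2_marginal ell2_norm_mult_left norm_mult mult.commute[of "cmod (a j)"]
        mult_right_mono)
qed

lemma
  assumes a: "a square_summable_on J"
    and k: "\<And>j. j \<in> J \<Longrightarrow> k j square_summable_on B" "\<And>j. j \<in> J \<Longrightarrow> ell2_norm B (k j) \<le> t"
  shows square_summable_on_mixture: "ell2_mixture J a k square_summable_on B"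
    and ell2_norm_mixture: "ell2_norm B (ell2_mixture J a k) = ell2_norm J (\<lambda>j. a j * ell2_norm B (k j))"
proof -
  note summable = square_summable_on_mult_left[OF k(1)] square_summable_on_marginal_mult[OF a k(2)]
  show "ell2_mixture J a k square_summable_on B"
    unfolding ell2_mixture_def by (rule square_summable_on_marginal[OF summable])
  have "ell2_norm B (ell2_mixture J a k) = ell2_norm J (ell2_marginal B (\<lambda>z j. a j * k j z))"
    unfolding ell2_mixture_def by (rule ell2_norm_marginal_swap[OF summable])
  also have "\<dots> = ell2_norm J (\<lambda>j. a j * ell2_norm B (k j))"
    by (intro ell2_norm_cong) (simp add: cmod_ell2_marginal ell2_norm_mult_left norm_mult)
  finally show "ell2_norm B (ell2_mixture J a k) = ell2_norm J (\<lambda>j. a j * ell2_norm B (k j))" .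
qed

lemma ell2_norm_mixture_le:
  assumes "a square_summable_on J" "0 \<le> t"
    and "\<And>j. j \<in> J \<Longrightarrow> k j square_summable_on B" "\<And>j. j \<in> J \<Longrightarrow> ell2_norm B (k j) \<le> t"
  shows "ell2_norm B (ell2_mixture J a k) \<le> t * ell2_norm J a"
proof -
  have "ell2_norm B (ell2_mixture J a k) = ell2_norm J (\<lambda>j. a j * ell2_norm B (k j))"
    using assms by (intro ell2_norm_mixture)
  also have "\<dots> \<le> ell2_norm J (\<lambda>j. complex_of_real t * a j)"
    using assms by (intro ell2_norm_mono square_summable_on_mult_left)
      (simp_all add: norm_mult mult.commute[of "cmod _" "ell2_norm _ _"] mult_right_mono)
  also have "\<dots> = t * ell2_norm J a"
    using \<open>0 \<le> t\<close> by (simp add: ell2_norm_mult_left)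
  finally show ?thesis .
qed

lemma
  assumes a: "a square_summable_on J"
    and k: "\<And>j. j \<in> J \<Longrightarrow> k j \<in> ell2 B" "\<And>j. j \<in> J \<Longrightarrow> ell2_norm B (k j) = 1"
  shows ell2_mixture_in_ell2: "ell2_mixture J a k \<in> ell2 B"
    and ell2_norm_mixture_unit: "ell2_norm B (ell2_mixture J a k) = ell2_norm J a"
proof -
  have k': "\<And>j. j \<in> J \<Longrightarrow> k j square_summable_on B" "\<And>j. j \<in> J \<Longrightarrow> ell2_norm B (k j) \<le> 1"
    using k by (simp_all add: ell2_iff)
  have "ell2_mixture J a k z = 0" if "z \<notin> B" for z
  proof -
    have "ell2_norm J (\<lambda>j. a j * k j z) = ell2_norm J (\<lambda>_. 0)"
      using k(1) that by (intro ell2_norm_cong) (simp add: ell2_iff)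
    then show ?thesis
      by (simp add: ell2_mixture_def ell2_marginal_def)
  qed
  then show "ell2_mixture J a k \<in> ell2 B"
    using square_summable_on_mixture[OF a k'] by (simp add: ell2_iff)
  have "ell2_norm B (ell2_mixture J a k) = ell2_norm J (\<lambda>j. a j * ell2_norm B (k j))"
    using a k' by (rule ell2_norm_mixture)
  also have "\<dots> = ell2_norm J a"
    by (intro ell2_norm_cong) (simp add: k(2))
  finally show "ell2_norm B (ell2_mixture J a k) = ell2_norm J a" .
qed

lemma
  assumes k: "k square_summable_on B" "ell2_norm B k = 1"
    and l: "l square_summable_on B" "ell2_norm B l = 1"
  shows ell2_norm_scaled_unit_diff_le_close:
      "ell2_norm B (\<lambda>z. s * k z - t * l z) \<le> cmod (s - t) + ell2_norm B (\<lambda>z. k z - l z) * cmod t"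
    and ell2_norm_scaled_unit_diff_le_left:
      "ell2_norm B (\<lambda>z. s * k z - t * l z) \<le> cmod (s - t) + 2 * cmod s"
    and ell2_norm_scaled_unit_diff_le_right:
      "ell2_norm B (\<lambda>z. s * k z - t * l z) \<le> cmod (s - t) + 2 * cmod t"
proof -
  have "ell2_norm B (\<lambda>z. s * k z - t * l z)
      \<le> ell2_norm B (\<lambda>z. (s - t) * k z) + ell2_norm B (\<lambda>z. t * (k z - l z))"
  proof (intro ell2_norm_dominated_add square_summable_on_mult_left square_summable_on_diff k l)
    fix z
    have "s * k z - t * l z = (s - t) * k z + t * (k z - l z)"
      by (simp add: algebra_simps)
    then show "cmod (s * k z - t * l z) \<le> cmod ((s - t) * k z) + cmod (t * (k z - l z))"
      by (simp only: norm_triangle_ineq)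
  qed
  then show "ell2_norm B (\<lambda>z. s * k z - t * l z) \<le> cmod (s - t) + ell2_norm B (\<lambda>z. k z - l z) * cmod t"
    by (simp only: ell2_norm_mult_left k(2) mult_1_right mult.commute[of "cmod t"])
  have "ell2_norm B (\<lambda>z. s * k z - t * l z) \<le> ell2_norm B (\<lambda>z. s * k z) + ell2_norm B (\<lambda>z. t * l z)"
    by (intro ell2_norm_triangle_ineq4 square_summable_on_mult_left k l)
  also have "\<dots> = cmod s + cmod t"
    by (simp add: ell2_norm_mult_left k l)
  finally show "ell2_norm B (\<lambda>z. s * k z - t * l z) \<le> cmod (s - t) + 2 * cmod s"
    and "ell2_norm B (\<lambda>z. s * k z - t * l z) \<le> cmod (s - t) + 2 * cmod t"
    using norm_triangle_sub[of s t] norm_triangle_sub[of t s] by (simp_all add: norm_minus_commute)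
qed

lemma ell2_norm_scaled_unit_diff_le_cases:
  assumes k: "k square_summable_on B" "ell2_norm B k = 1"
    and l: "l square_summable_on B" "ell2_norm B l = 1"
    and close: "\<not> p \<Longrightarrow> \<not> q \<Longrightarrow> ell2_norm B (\<lambda>z. k z - l z) \<le> \<delta>" and "0 \<le> \<delta>"
  shows "ell2_norm B (\<lambda>z. s * k z - t * l z)
    \<le> cmod (s - t) + \<delta> * cmod t + 2 * cmod (if p then s else 0) + 2 * cmod (if q then t else 0)"
proof -
  have nonneg: "0 \<le> \<delta> * cmod t" "0 \<le> cmod s" "0 \<le> cmod t"
    using \<open>0 \<le> \<delta>\<close> by simp_all
  consider (left) p | (right) q | (neither) "\<not> p" "\<not> q"
    by blast
  then show ?thesis
  proof cases
    case left
    then show ?thesis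
      using ell2_norm_scaled_unit_diff_le_left[OF k l, of s t] nonneg
      by (cases q; simp only: if_True if_False norm_zero; linarith)
  next
    case right
    then show ?thesis
      using ell2_norm_scaled_unit_diff_le_right[OF k l, of s t] nonneg
      by (cases p; simp only: if_True if_False norm_zero; linarith)
  next
    case neither
    then have "ell2_norm B (\<lambda>z. k z - l z) * cmod t \<le> \<delta> * cmod t"
      by (intro mult_right_mono close) auto
    with neither show ?thesis
      using ell2_norm_scaled_unit_diff_le_close[OF k l, of s t] by simp
  qed
qed

(* P and Q are meant to carry little of the mass of a and of b; on them k - l need not be small. *)
lemma ell2_norm_mixture_diff_le:
  assumes a: "a square_summable_on J" and b: "b square_summable_on J" and "P \<subseteq> J" "Q \<subseteq> J" "0 \<le> \<delta>"
    and k: "\<And>j. j \<in> J \<Longrightarrow> k j square_summable_on B" "\<And>j. j \<in> J \<Longrightarrow> ell2_norm B (k j) = 1"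
    and l: "\<And>j. j \<in> J \<Longrightarrow> l j square_summable_on B" "\<And>j. j \<in> J \<Longrightarrow> ell2_norm B (l j) = 1"
    and close: "\<And>j. j \<in> J - P - Q \<Longrightarrow> ell2_norm B (\<lambda>z. k j z - l j z) \<le> \<delta>"
  shows "ell2_norm B (\<lambda>z. ell2_mixture J a k z - ell2_mixture J b l z)
    \<le> ell2_norm J (\<lambda>j. a j - b j) + \<delta> * ell2_norm J b + 2 * ell2_norm P a + 2 * ell2_norm Q b"
proof -
  define fs where "fs = [\<lambda>j. a j - b j, \<lambda>j. \<delta> * b j,
    \<lambda>j. 2 * (if j \<in> P then a j else 0), \<lambda>j. 2 * (if j \<in> Q then b j else 0)]"
  define h where "h = ell2_marginal B (\<lambda>z j. a j * k j z - b j * l j z)"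
  have fs_summable: "\<And>f. f \<in> set fs \<Longrightarrow> f square_summable_on J"
    unfolding fs_def using assms
    by (auto intro: square_summable_on_diff square_summable_on_mult_left square_summable_on_restrict)
  have h_le: "cmod (h j) \<le> (\<Sum>f\<leftarrow>fs. cmod (f j))" if "j \<in> J" for j
    using ell2_norm_scaled_unit_diff_le_cases[OF k[OF that] l[OF that],
        of "j \<in> P" "j \<in> Q" \<delta> "a j" "b j"] close[of j] that \<open>0 \<le> \<delta>\<close>
    by (simp add: h_def fs_def cmod_ell2_marginal norm_mult add.assoc)
  have "ell2_norm B (\<lambda>z. ell2_mixture J a k z - ell2_mixture J b l z) \<le> ell2_norm J h"
    unfolding ell2_mixture_def h_def
    by (rule ell2_norm_marginal_diff_le[OF square_summable_on_mult_left[OF k(1)]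
          square_summable_on_marginal_mult[OF a, where t = 1] square_summable_on_mult_left[OF l(1)]
          square_summable_on_marginal_mult[OF b, where t = 1]]) (simp_all add: k(2) l(2))
  also have "\<dots> \<le> (\<Sum>f\<leftarrow>fs. ell2_norm J f)"
    using ell2_norm_dominated_sum_list[OF fs_summable h_le] by simp
  also have "\<dots> = ell2_norm J (\<lambda>j. a j - b j) + \<delta> * ell2_norm J b + 2 * ell2_norm P a + 2 * ell2_norm Q b"
    unfolding fs_def using assms
    by (simp add: ell2_norm_mult_left[of _ 2] ell2_norm_mult_left[of _ "complex_of_real \<delta>"]
        ell2_norm_restrict)
  finally show ?thesis .
qed

section \<open>Localized families of unit vectors\<close>

definition localized_unit_vectors ::
    "'a set \<Rightarrow> ('a \<Rightarrow> 'a \<Rightarrow> real) \<Rightarrow> real \<Rightarrow> real \<Rightarrow> 'w set \<Rightarrow> ('a \<Rightarrow> real \<Rightarrow> 'w set) \<Rightarrow>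
      ('a \<Rightarrow> 'w \<Rightarrow> complex) \<Rightarrow> bool" where
  "localized_unit_vectors X d R \<epsilon> A far \<xi> \<longleftrightarrow>
     (\<forall>x\<in>X. \<xi> x \<in> ell2 A \<and> ell2_norm A (\<xi> x) = 1) \<and>
     (\<forall>x\<in>X. \<forall>y\<in>X. d x y \<le> R \<longrightarrow> ell2_norm A (\<lambda>w. \<xi> x w - \<xi> y w) \<le> \<epsilon>) \<and>
     (\<forall>e>0. \<forall>\<^sub>F S in at_top. \<forall>x\<in>X. ell2_norm (far x S) (\<xi> x) \<le> e)"

definition strongly_embeddable_into ::
    "'a set \<Rightarrow> ('a \<Rightarrow> 'a \<Rightarrow> real) \<Rightarrow> 'w set \<Rightarrow> ('a \<Rightarrow> real \<Rightarrow> 'w set) \<Rightarrow> bool" where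
  "strongly_embeddable_into X d A far \<longleftrightarrow>
     (\<forall>R>0. \<forall>\<epsilon>>0. \<exists>\<xi>. localized_unit_vectors X d R \<epsilon> A far \<xi>)"

lemma ennreal_tendsto_zero_iff_power2:
  fixes f :: "'s \<Rightarrow> ennreal"
  shows "(f \<longlongrightarrow> 0) F \<longleftrightarrow> (\<forall>e>0. \<forall>\<^sub>F S in F. f S \<le> ennreal (e\<^sup>2))"
proof
  assume "(f \<longlongrightarrow> 0) F"
  then have "\<forall>\<^sub>F S in F. f S < ennreal (e\<^sup>2)" if "0 < e" for e :: real
    using that by (intro order_tendstoD(2)) auto
  then show "\<forall>e>0. \<forall>\<^sub>F S in F. f S \<le> ennreal (e\<^sup>2)"
    by (blast intro: eventually_mono order_less_imp_le)
next
  assume bound: "\<forall>e>0. \<forall>\<^sub>F S in F. f S \<le> ennreal (e\<^sup>2)"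
  show "(f \<longlongrightarrow> 0) F"
  proof (rule order_tendstoI)
    fix a :: ennreal assume "0 < a"
    then obtain b where "0 < b" "b < a"
      using dense by blast
    then obtain r where "0 < r" "ennreal r < a"
      by (cases b) auto
    then have "\<forall>\<^sub>F S in F. f S \<le> ennreal r"
      using bound[rule_format, of "sqrt r"] by simp
    then show "\<forall>\<^sub>F S in F. f S < a"
      using \<open>ennreal r < a\<close> by (auto elim: eventually_mono)
  qed simp
qed

lemma ell2_tails_tendsto_zero_iff:
  "((\<lambda>S. SUP i\<in>I. ennreal (\<Sum>\<^sub>\<infinity>w\<in>A S i. (cmod (f i w))\<^sup>2)) \<longlongrightarrow> 0) F \<longleftrightarrow>
    (\<forall>e>0. \<forall>\<^sub>F S in F. \<forall>i\<in>I. ell2_norm (A S i) (f i) \<le> e)"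
  by (simp add: ennreal_tendsto_zero_iff_power2 SUP_le_iff
      infsum_le_power2_iff_ell2_norm_le cong: imp_cong)

lemma strongly_embeddable_iff_into:
  "strongly_embeddable X d \<longleftrightarrow> strongly_embeddable_into X d X (\<lambda>x S. X - Metric_space.mball X d x S)"
  by (simp add: strongly_embeddable_def strongly_embeddable_into_def localized_unit_vectors_def
      ell2_tails_tendsto_zero_iff)

lemma strongly_embeddable_maps_iff_into:
  "strongly_embeddable_maps X d n Y \<phi> \<longleftrightarrow> strongly_embeddable_into X d (Sigma {1..n} Y)
    (\<lambda>x S. Sigma {1..n} Y - (\<Union>i\<in>{1..n}. (\<lambda>y. (i, \<phi> i y)) ` Metric_space.mball X d x S))"
  by (simp add: strongly_embeddable_maps_def strongly_embeddable_into_def localized_unit_vectors_def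
      ell2_tails_tendsto_zero_iff)

lemma equi_ell2_tails_tendsto_zero_iff:
  "((\<lambda>S. SUP j\<in>J. SUP x\<in>X j. ennreal (\<Sum>\<^sub>\<infinity>w\<in>A S j x. (cmod (\<xi> j x w))\<^sup>2)) \<longlongrightarrow> 0) F \<longleftrightarrow>
    (\<forall>e>0. \<forall>\<^sub>F S in F. \<forall>j\<in>J. \<forall>x\<in>X j. ell2_norm (A S j x) (\<xi> j x) \<le> e)"
  by (simp add: ennreal_tendsto_zero_iff_power2 SUP_le_iff
      infsum_le_power2_iff_ell2_norm_le cong: imp_cong)

lemma equi_strongly_embeddableE:
  assumes "equi_strongly_embeddable J X d" "0 < R" "0 < \<epsilon>"
  obtains \<xi> where
    "\<And>j x. j \<in> J \<Longrightarrow> x \<in> X j \<Longrightarrow> \<xi> j x \<in> ell2 (X j)"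
    "\<And>j x. j \<in> J \<Longrightarrow> x \<in> X j \<Longrightarrow> ell2_norm (X j) (\<xi> j x) = 1"
    "\<And>j x y. j \<in> J \<Longrightarrow> x \<in> X j \<Longrightarrow> y \<in> X j \<Longrightarrow> d j x y \<le> R \<Longrightarrow>
      ell2_norm (X j) (\<lambda>w. \<xi> j x w - \<xi> j y w) \<le> \<epsilon>"
    "\<And>e. 0 < e \<Longrightarrow> \<forall>\<^sub>F S in at_top. \<forall>j\<in>J. \<forall>x\<in>X j.
      ell2_norm (X j - Metric_space.mball (X j) (d j) x S) (\<xi> j x) \<le> e"
  using assms(1)[unfolded equi_strongly_embeddable_def equi_ell2_tails_tendsto_zero_iff,
      rule_format, OF assms(2,3)]
  by (elim exE conjE) (rule that, auto)

lemma localized_unit_vectors_obtain_radius: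
  assumes "localized_unit_vectors X d R \<epsilon> A far \<xi>" "0 < e"
  obtains T where "0 < T" "\<And>x. x \<in> X \<Longrightarrow> ell2_norm (far x T) (\<xi> x) \<le> e"
proof -
  have "\<forall>\<^sub>F T in at_top. \<forall>x\<in>X. ell2_norm (far x T) (\<xi> x) \<le> e"
    using assms by (simp add: localized_unit_vectors_def)
  then have "\<forall>\<^sub>F T in at_top. 0 < T \<and> (\<forall>x\<in>X. ell2_norm (far x T) (\<xi> x) \<le> e)"
    by (intro eventually_conj eventually_gt_at_top)
  then show ?thesis
    using eventually_happens'[OF trivial_limit_at_top_linorder] that by blast
qed

lemma localized_unit_vectors_mixture:
  assumes \<xi>: "localized_unit_vectors X d R \<delta> J far \<xi>" and "0 \<le> \<delta>"
    and far: "\<And>x. x \<in> X \<Longrightarrow> far x T \<subseteq> J" "\<And>x. x \<in> X \<Longrightarrow> ell2_norm (far x T) (\<xi> x) \<le> \<delta>"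
    and k: "\<And>x j. x \<in> X \<Longrightarrow> j \<in> J \<Longrightarrow> k x j \<in> ell2 B"
      "\<And>x j. x \<in> X \<Longrightarrow> j \<in> J \<Longrightarrow> ell2_norm B (k x j) = 1"
    and k_diff: "\<And>x y j. x \<in> X \<Longrightarrow> y \<in> X \<Longrightarrow> d x y \<le> R \<Longrightarrow> j \<in> J - far x T - far y T \<Longrightarrow>
      ell2_norm B (\<lambda>z. k x j z - k y j z) \<le> \<delta>"
    and k_tail: "\<And>e. 0 < e \<Longrightarrow> \<forall>\<^sub>F S in at_top. \<forall>x\<in>X. \<forall>j\<in>J. ell2_norm (off x S) (k x j) \<le> e"
  shows "localized_unit_vectors X d R (6 * \<delta>) B off (\<lambda>x. ell2_mixture J (\<xi> x) (k x))"
  unfolding localized_unit_vectors_def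
proof (intro conjI ballI impI allI)
  have \<xi>_summable: "\<xi> x square_summable_on J" and \<xi>_norm: "ell2_norm J (\<xi> x) = 1" if "x \<in> X" for x
    using \<xi> that by (auto simp: localized_unit_vectors_def ell2_iff)
  show "ell2_mixture J (\<xi> x) (k x) \<in> ell2 B" if "x \<in> X" for x
    using \<xi>_summable k that by (intro ell2_mixture_in_ell2) auto
  show "ell2_norm B (ell2_mixture J (\<xi> x) (k x)) = 1" if "x \<in> X" for x
    using ell2_norm_mixture_unit[of "\<xi> x" J "k x" B] \<xi>_summable \<xi>_norm k that by simp
  show "ell2_norm B (\<lambda>z. ell2_mixture J (\<xi> x) (k x) z - ell2_mixture J (\<xi> y) (k y) z) \<le> 6 * \<delta>"
    if xy: "x \<in> X" "y \<in> X" "d x y \<le> R" for x y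
  proof -
    have "ell2_norm B (\<lambda>z. ell2_mixture J (\<xi> x) (k x) z - ell2_mixture J (\<xi> y) (k y) z)
        \<le> ell2_norm J (\<lambda>j. \<xi> x j - \<xi> y j) + \<delta> * ell2_norm J (\<xi> y)
          + 2 * ell2_norm (far x T) (\<xi> x) + 2 * ell2_norm (far y T) (\<xi> y)"
      using xy \<xi>_summable far(1) k k_diff \<open>0 \<le> \<delta>\<close>
      by (intro ell2_norm_mixture_diff_le) (auto simp: ell2_iff)
    moreover have "ell2_norm J (\<lambda>j. \<xi> x j - \<xi> y j) \<le> \<delta>"
      using \<xi> xy by (auto simp: localized_unit_vectors_def)
    ultimately show ?thesis
      using far(2)[of x] far(2)[of y] \<xi>_norm[of y] xy by simp
  qed
  show "\<forall>\<^sub>F S in at_top. \<forall>x\<in>X. ell2_norm (off x S) (ell2_mixture J (\<xi> x) (k x)) \<le> e"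
    if "0 < e" for e
    using k_tail[OF that]
  proof eventually_elim
    fix S assume tail: "\<forall>x\<in>X. \<forall>j\<in>J. ell2_norm (off x S) (k x j) \<le> e"
    show "\<forall>x\<in>X. ell2_norm (off x S) (ell2_mixture J (\<xi> x) (k x)) \<le> e"
    proof
      fix x assume "x \<in> X"
      then have "ell2_norm (off x S) (ell2_mixture J (\<xi> x) (k x)) \<le> e * ell2_norm J (\<xi> x)"
        using \<xi>_summable k(1) tail that
        by (intro ell2_norm_mixture_le square_summable_on_if_ell2[of "k x _" B]) auto
      then show "ell2_norm (off x S) (ell2_mixture J (\<xi> x) (k x)) \<le> e"
        using \<xi>_norm \<open>x \<in> X\<close> by simp
    qed
  qed
qed

section \<open>Mixing along a family of subspaces\<close>

definition nearby_vector ::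
    "('a \<Rightarrow> 'a \<Rightarrow> real) \<Rightarrow> real \<Rightarrow> 'a set \<Rightarrow> ('a \<Rightarrow> 'a \<Rightarrow> complex) \<Rightarrow> 'a \<Rightarrow> 'a \<Rightarrow> complex" where
  "nearby_vector d T A \<eta> x =
     (if \<exists>p\<in>A. d x p < T then \<eta> (SOME p. p \<in> A \<and> d x p < T) else ell2_dirac x)"

lemma nearby_vector_cases [case_names near far]:
  obtains p where "p \<in> A" "d x p < T" "nearby_vector d T A \<eta> x = \<eta> p"
  | "\<And>p. p \<in> A \<Longrightarrow> T \<le> d x p" "nearby_vector d T A \<eta> x = ell2_dirac x"
proof (cases "\<exists>p\<in>A. d x p < T")
  case True
  define p where "p = (SOME p. p \<in> A \<and> d x p < T)"
  have "p \<in> A \<and> d x p < T"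
    unfolding p_def by (rule someI_ex) (use True in blast)
  moreover have "nearby_vector d T A \<eta> x = \<eta> p"
    by (simp only: nearby_vector_def p_def True if_True)
  ultimately show ?thesis
    using that(1) by blast
next
  case False
  then show ?thesis
    by (intro that(2)) (auto simp: nearby_vector_def not_less)
qed

lemma (in Metric_space)
  assumes "x \<in> M" "A \<subseteq> M"
    and \<eta>: "\<And>p. p \<in> A \<Longrightarrow> \<eta> p \<in> ell2 A" "\<And>p. p \<in> A \<Longrightarrow> ell2_norm A (\<eta> p) = 1"
  shows nearby_vector_in_ell2: "nearby_vector d T A \<eta> x \<in> ell2 M"
    and ell2_norm_nearby_vector: "ell2_norm M (nearby_vector d T A \<eta> x) = 1"
proof (atomize(full), cases rule: nearby_vector_cases[of A d x T \<eta>])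
  case (near p)
  then have "\<eta> p \<in> ell2 M"
    using \<eta>(1)[of p] \<open>A \<subseteq> M\<close> by (auto simp: ell2_iff[of _ M] square_summable_on_if_ell2) (auto simp: ell2_iff)
  moreover have "ell2_norm M (\<eta> p) = 1"
    using near \<eta> \<open>A \<subseteq> M\<close> ell2_norm_eq_Int[of "\<eta> p" A M] by (simp add: Int_absorb2)
  ultimately show "nearby_vector d T A \<eta> x \<in> ell2 M \<and> ell2_norm M (nearby_vector d T A \<eta> x) = 1"
    by (simp add: near)
next
  case far
  then show "nearby_vector d T A \<eta> x \<in> ell2 M \<and> ell2_norm M (nearby_vector d T A \<eta> x) = 1"
    using \<open>x \<in> M\<close> by (simp add: ell2_dirac_in_ell2 ell2_norm_dirac)
qed

lemma (in Metric_space) ell2_norm_nearby_vector_diff_le: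
  assumes xy: "x \<in> M" "y \<in> M" "d x y \<le> R" and "A \<subseteq> M"
    and meets: "A \<inter> mball x T \<noteq> {}" "A \<inter> mball y T \<noteq> {}"
    and \<eta>: "\<And>p. p \<in> A \<Longrightarrow> \<eta> p \<in> ell2 A"
    and \<eta>_diff: "\<And>p q. p \<in> A \<Longrightarrow> q \<in> A \<Longrightarrow> d p q \<le> R + 2 * T \<Longrightarrow>
      ell2_norm A (\<lambda>w. \<eta> p w - \<eta> q w) \<le> \<delta>"
  shows "ell2_norm M (\<lambda>w. nearby_vector d T A \<eta> x w - nearby_vector d T A \<eta> y w) \<le> \<delta>"
proof -
  obtain p where p: "p \<in> A" "d x p < T" "nearby_vector d T A \<eta> x = \<eta> p"
    using meets(1) by (cases rule: nearby_vector_cases[of A d x T \<eta>]) force+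
  obtain q where q: "q \<in> A" "d y q < T" "nearby_vector d T A \<eta> y = \<eta> q"
    using meets(2) by (cases rule: nearby_vector_cases[of A d y T \<eta>]) force+
  have "p \<in> M" "q \<in> M"
    using p q \<open>A \<subseteq> M\<close> by auto
  then have "d p q \<le> d x p + d x y + d y q"
    using xy triangle[of p x q] triangle[of x y q] commute[of x p] by simp
  then have "d p q \<le> R + 2 * T"
    using xy p q by simp
  moreover have "(\<lambda>w. \<eta> p w - \<eta> q w) \<in> ell2 A"
    using \<eta>[OF p(1)] \<eta>[OF q(1)] by (simp add: ell2_iff square_summable_on_diff)
  then have "ell2_norm M (\<lambda>w. \<eta> p w - \<eta> q w) = ell2_norm A (\<lambda>w. \<eta> p w - \<eta> q w)"
    using ell2_norm_eq_Int[of _ A M] \<open>A \<subseteq> M\<close> by (simp add: Int_absorb2)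
  ultimately show ?thesis
    using \<eta>_diff[OF p(1) q(1)] by (simp add: p q)
qed

lemma (in Metric_space) ell2_norm_nearby_vector_tail_le:
  assumes "x \<in> M" "A \<subseteq> M" "0 < S + T" "0 \<le> e"
    and \<eta>: "\<And>p. p \<in> A \<Longrightarrow> \<eta> p \<in> ell2 A"
    and \<eta>_tail: "\<And>p. p \<in> A \<Longrightarrow> ell2_norm (A - Metric_space.mball A d p S) (\<eta> p) \<le> e"
  shows "ell2_norm (M - mball x (S + T)) (nearby_vector d T A \<eta> x) \<le> e"
proof (cases rule: nearby_vector_cases[of A d x T \<eta>])
  case (near p)
  interpret A: Metric_space A d
    using \<open>A \<subseteq> M\<close> by (rule subspace)
  have "A \<inter> (M - mball x (S + T)) \<subseteq> A - A.mball p S"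
  proof safe
    fix z assume z: "z \<in> A" "z \<in> M" "z \<notin> mball x (S + T)" "z \<in> A.mball p S"
    then have "d x z \<le> d x p + d p z"
      using near \<open>x \<in> M\<close> \<open>A \<subseteq> M\<close> by (intro triangle) auto
    then show False
      using z near \<open>x \<in> M\<close> by auto
  qed
  then have "ell2_norm (A \<inter> (M - mball x (S + T))) (\<eta> p) \<le> ell2_norm (A - A.mball p S) (\<eta> p)"
    using \<eta>[OF near(1)] by (intro ell2_norm_subset_le square_summable_on_if_ell2)
  also have "\<dots> \<le> e"
    using near(1) by (rule \<eta>_tail)
  finally show ?thesis
    using ell2_norm_eq_Int[OF \<eta>[OF near(1)]] by (simp add: near)
next
  case far
  then show ?thesis
    using assms(1,3,4) by (simp add: ell2_norm_dirac)
qed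

lemma (in Metric_space) eventually_ell2_norm_nearby_vector_tail_le:
  assumes F: "\<And>j. j \<in> J \<Longrightarrow> F j \<subseteq> M"
    and \<eta>: "\<And>j p. j \<in> J \<Longrightarrow> p \<in> F j \<Longrightarrow> \<eta> j p \<in> ell2 (F j)"
    and \<eta>_tail: "\<forall>\<^sub>F S in at_top. \<forall>j\<in>J. \<forall>p\<in>F j.
      ell2_norm (F j - Metric_space.mball (F j) d p S) (\<eta> j p) \<le> e"
    and "0 \<le> e"
  shows "\<forall>\<^sub>F S in at_top. \<forall>x\<in>M. \<forall>j\<in>J.
    ell2_norm (M - mball x S) (nearby_vector d T (F j) (\<eta> j) x) \<le> e"
proof -
  have "LIM S at_top. S - T :> at_top"
    using filterlim_tendsto_add_at_top[OF tendsto_const[of "- T"] filterlim_ident] by simp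
  from eventually_compose_filterlim[OF \<eta>_tail this] eventually_gt_at_top[of 0]
  show ?thesis
  proof eventually_elim
    case (elim S)
    then show ?case
      using ell2_norm_nearby_vector_tail_le[where S = "S - T" and T = T] F \<eta> \<open>0 \<le> e\<close> by simp
  qed
qed

theorem (in Metric_space) strongly_embeddable_if_equi_family:
  assumes F: "\<And>j. j \<in> J \<Longrightarrow> F j \<subseteq> M"
    and into: "strongly_embeddable_into M d J (\<lambda>x S. {j \<in> J. F j \<inter> mball x S = {}})"
    and equi: "equi_strongly_embeddable J F (\<lambda>_. d)"
  shows "strongly_embeddable M d"
  unfolding strongly_embeddable_iff_into strongly_embeddable_into_def
proof (intro allI impI)
  fix R \<epsilon> :: real
  assume "0 < R" "0 < \<epsilon>"
  define \<delta> where "\<delta> = \<epsilon> / 6"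
  have "0 < \<delta>"
    using \<open>0 < \<epsilon>\<close> by (simp add: \<delta>_def)
  define far where "far x S = {j \<in> J. F j \<inter> mball x S = {}}" for x S
  obtain \<xi> where \<xi>: "localized_unit_vectors M d R \<delta> J far \<xi>"
    using into \<open>0 < R\<close> \<open>0 < \<delta>\<close> unfolding strongly_embeddable_into_def far_def by blast
  obtain T where "0 < T" and far_le: "\<And>x. x \<in> M \<Longrightarrow> ell2_norm (far x T) (\<xi> x) \<le> \<delta>"
    by (rule localized_unit_vectors_obtain_radius[OF \<xi> \<open>0 < \<delta>\<close>]) (rule that)
  have "0 < R + 2 * T"
    using \<open>0 < R\<close> \<open>0 < T\<close> by simp
  obtain \<eta> where
    \<eta>: "\<And>j p. j \<in> J \<Longrightarrow> p \<in> F j \<Longrightarrow> \<eta> j p \<in> ell2 (F j)"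
      "\<And>j p. j \<in> J \<Longrightarrow> p \<in> F j \<Longrightarrow> ell2_norm (F j) (\<eta> j p) = 1" and
    \<eta>_diff: "\<And>j p q. j \<in> J \<Longrightarrow> p \<in> F j \<Longrightarrow> q \<in> F j \<Longrightarrow> d p q \<le> R + 2 * T \<Longrightarrow>
        ell2_norm (F j) (\<lambda>w. \<eta> j p w - \<eta> j q w) \<le> \<delta>" and
    \<eta>_tail: "\<And>e. 0 < e \<Longrightarrow> \<forall>\<^sub>F S in at_top. \<forall>j\<in>J. \<forall>p\<in>F j.
        ell2_norm (F j - Metric_space.mball (F j) d p S) (\<eta> j p) \<le> e"
    by (rule equi_strongly_embeddableE[OF equi \<open>0 < R + 2 * T\<close> \<open>0 < \<delta>\<close>]) (rule that)
  define k where "k x j = nearby_vector d T (F j) (\<eta> j) x" for x j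
  have "localized_unit_vectors M d R (6 * \<delta>) M (\<lambda>x S. M - mball x S) (\<lambda>x. ell2_mixture J (\<xi> x) (k x))"
  proof (rule localized_unit_vectors_mixture[OF \<xi> _ _ far_le])
    show "k x j \<in> ell2 M" "ell2_norm M (k x j) = 1" if "x \<in> M" "j \<in> J" for x j
      unfolding k_def using that F \<eta> by (simp_all add: nearby_vector_in_ell2 ell2_norm_nearby_vector)
    show "ell2_norm M (\<lambda>z. k x j z - k y j z) \<le> \<delta>"
      if "x \<in> M" "y \<in> M" "d x y \<le> R" "j \<in> J - far x T - far y T" for x y j
      unfolding k_def using that F \<eta>(1) \<eta>_diff
      by (intro ell2_norm_nearby_vector_diff_le) (auto simp: far_def)
    show "\<forall>\<^sub>F S in at_top. \<forall>x\<in>M. \<forall>j\<in>J. ell2_norm (M - mball x S) (k x j) \<le> e" if "0 < e" for e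
      unfolding k_def using that F \<eta>(1) \<eta>_tail
      by (intro eventually_ell2_norm_nearby_vector_tail_le) auto
  qed (use \<open>0 < \<delta>\<close> in \<open>auto simp: far_def\<close>)
  then show "\<exists>\<beta>. localized_unit_vectors M d R \<epsilon> M (\<lambda>x S. M - mball x S) \<beta>"
    by (auto simp: \<delta>_def)
qed

theorem corollary4p7:
  fixes X :: "'a set" and d :: "'a \<Rightarrow> 'a \<Rightarrow> real"
    and n :: nat and Y :: "nat \<Rightarrow> 'b set" and \<phi> :: "nat \<Rightarrow> 'a \<Rightarrow> 'b"
  assumes "Metric_space X d"
    and "uniformly_discrete X d"
    and "bounded_geometry X d"
    and "\<forall>i\<in>{1..n}. \<phi> i \<in> X \<rightarrow> Y i"
    and "strongly_embeddable_maps X d n Y \<phi>"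
    and "equi_strongly_embeddable (Sigma {1..n} Y) (\<lambda>(i, w). {x \<in> X. \<phi> i x = w}) (\<lambda>_. d)"
  shows "strongly_embeddable X d"
proof -
  interpret Metric_space X d by fact
  define F where "F = (\<lambda>(i, w). {x \<in> X. \<phi> i x = w})"
  have "Sigma {1..n} Y - (\<Union>i\<in>{1..n}. (\<lambda>y. (i, \<phi> i y)) ` mball x S) =
      {j \<in> Sigma {1..n} Y. F j \<inter> mball x S = {}}" for x S
    by (force simp: F_def)
  then have "strongly_embeddable_into X d (Sigma {1..n} Y)
      (\<lambda>x S. {j \<in> Sigma {1..n} Y. F j \<inter> mball x S = {}})"
    using assms(5) by (simp add: strongly_embeddable_maps_iff_into)
  then show ?thesis
    using assms(6) by (intro strongly_embeddable_if_equi_family[of "Sigma {1..n} Y" F]) (auto simp: F_def)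
qed

end
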